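(* Let $d,n\in\mathbb{N}$ and let $g,\tilde g\in\mathbb{R}[\mathbf{x}]$ be polynomials of degree $d$ such that $\mathbf{G}=\{\mathbf{x}\in\mathbb{R}^n:g(\mathbf{x})<1\}$ and $\tilde{\mathbf{G}}=\{\mathbf{x}:\tilde g(\mathbf{x})<1\}$ are bounded, and $g(0)\neq1$, $\tilde g(0)\ne1$. (i) If $\int_{\mathbf{G}}\mathbf{x}^\alpha d\mathbf{x}=\int_{\tilde{\mathbf{G}}}\mathbf{x}^\alpha d\mathbf{x}$ for all $\alpha\in\mathbb{N}^n$ with $|\alpha|\le 3d$, then this equality holds for all $\alpha\in\mathbb{N}^n$; that is, the full moment sequence of Lebesgue measure restricted to $\mathbf{G}$ is determined by its moments of order at most $3d$. (ii) Let moreover $p\in\mathbb{R}[\mathbf{x}]$ have degree at most $t$. If $\int_{\mathbf{G}}\mathbf{x}^\alpha e^{p(\mathbf{x})}d\mathbf{x}=\int_{\tilde{\mathbf{G}}}\mathbf{x}^\alpha e^{p(\mathbf{x})}d\mathbf{x}$ for all $|\alpha|\le 3d+t$, then this equality holds for all $\alpha\in\mathbb{N}^n$.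
   Context: $\mathbf{x}^\alpha=x_1^{\alpha_1}\cdots x_n^{\alpha_n}$, $|\alpha|=\sum_i\alpha_i$; integrals with respect to Lebesgue measure. *)

theory Defs
  imports "HOL-Analysis.Analysis"
begin

text \<open>Multivariate real polynomials in n variables, n = CARD('n), represented by their
  coefficient functions on exponent vectors alpha :: 'n => nat (finite support).\<close>

definition monom :: "real ^ 'n \<Rightarrow> ('n::finite \<Rightarrow> nat) \<Rightarrow> real" where
  "monom x \<alpha> = (\<Prod>i\<in>UNIV. (x $ i) ^ (\<alpha> i))"

definition mdeg :: "('n::finite \<Rightarrow> nat) \<Rightarrow> nat" where
  "mdeg \<alpha> = (\<Sum>i\<in>UNIV. \<alpha> i)"

definition is_mpoly :: "(('n::finite \<Rightarrow> nat) \<Rightarrow> real) \<Rightarrow> bool" where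
  "is_mpoly c \<longleftrightarrow> finite {\<alpha>. c \<alpha> \<noteq> 0}"

definition meval :: "(('n::finite \<Rightarrow> nat) \<Rightarrow> real) \<Rightarrow> real ^ 'n \<Rightarrow> real" where
  "meval c x = (\<Sum>\<alpha>\<in>{\<alpha>. c \<alpha> \<noteq> 0}. c \<alpha> * monom x \<alpha>)"

definition mpoly_degree_eq :: "(('n::finite \<Rightarrow> nat) \<Rightarrow> real) \<Rightarrow> nat \<Rightarrow> bool" where
  "mpoly_degree_eq c d \<longleftrightarrow> is_mpoly c \<and> (\<forall>\<alpha>. c \<alpha> \<noteq> 0 \<longrightarrow> mdeg \<alpha> \<le> d)
      \<and> (\<exists>\<alpha>. c \<alpha> \<noteq> 0 \<and> mdeg \<alpha> = d)"

definition mpoly_degree_le :: "(('n::finite \<Rightarrow> nat) \<Rightarrow> real) \<Rightarrow> nat \<Rightarrow> bool" where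
  "mpoly_degree_le c t \<longleftrightarrow> is_mpoly c \<and> (\<forall>\<alpha>. c \<alpha> \<noteq> 0 \<longrightarrow> mdeg \<alpha> \<le> t)"

end

theory Submission
  imports Defs
begin

text \<open>
  On \<open>G - G'\<close> one has \<open>g < 1 \<le> g'\<close>, and on \<open>G' - G\<close> one has \<open>g' < 1 \<le> g\<close>. Hence
  \<open>(1\<^sub>G - 1\<^sub>G\<^sub>') (g' - g)\<close> is nonnegative, and positive exactly on the symmetric
  difference. Its integral against a positive weight is a combination of differences of moments of
  order at most \<open>d\<close>; if these agree, the symmetric difference is a null set, and then all
  moments agree.
\<close>

lemma continuous_on_monom [continuous_intros]: "continuous_on S (\<lambda>x. monom x \<alpha>)"
  unfolding monom_def by (intro continuous_intros)

lemma continuous_on_meval [continuous_intros]: "continuous_on S (meval c)"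
  unfolding meval_def by (intro continuous_intros)

lemma open_meval_less: "open {x. meval c x < a}"
  by (intro open_Collect_less continuous_intros)

text \<open>The closure of a bounded set is compact, so \<open>f\<close> is integrable there, and
  integrability passes to measurable subsets.\<close>

lemma set_integrable_bounded_continuous:
  fixes f :: "'a::euclidean_space \<Rightarrow> real"
  assumes "bounded S" "S \<in> sets borel" "continuous_on UNIV f"
  shows "set_integrable lborel S f"
proof -
  have "set_integrable lborel (closure S) f"
    unfolding set_integrable_def
    using assms by (intro borel_integrable_compact) (auto intro: continuous_on_subset)
  then show ?thesis
    by (rule set_integrable_subset) (use assms closure_subset in auto)
qed

text \<open>Linearity of the integral, each term being integrable because \<open>S\<close> is
  bounded. For \<open>c\<close> of infinite support both sides are 0, the default value of an
  infinite sum.\<close>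

lemma set_integral_meval:
  fixes w :: "real ^ 'n::finite \<Rightarrow> real"
  assumes "bounded S" "S \<in> sets borel" "continuous_on UNIV w"
  shows "(LINT x:S|lborel. meval c x * w x)
       = (\<Sum>\<alpha> | c \<alpha> \<noteq> 0. c \<alpha> * (LINT x:S|lborel. monom x \<alpha> * w x))"
proof -
  have int: "set_integrable lborel S (\<lambda>x. monom x \<alpha> * w x)" for \<alpha>
    using assms by (intro set_integrable_bounded_continuous continuous_intros)
  have "(LINT x:S|lborel. meval c x * w x)
      = (LINT x|lborel. (\<Sum>\<alpha> | c \<alpha> \<noteq> 0. c \<alpha> * (indicator S x *\<^sub>R (monom x \<alpha> * w x))))"
    unfolding set_lebesgue_integral_def meval_def
    by (simp add: sum_distrib_left sum_distrib_right mult_ac)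
  also have "\<dots> = (\<Sum>\<alpha> | c \<alpha> \<noteq> 0. c \<alpha> * (LINT x:S|lborel. monom x \<alpha> * w x))"
    using int unfolding set_lebesgue_integral_def set_integrable_def
    by (subst Bochner_Integration.integral_sum) auto
  finally show ?thesis .
qed

text \<open>The weight is left general so that both 1 and \<open>exp (meval p x)\<close> are
  instances.\<close>

lemma weighted_moments_determine_sublevel_set:
  fixes g g' :: "('n::finite \<Rightarrow> nat) \<Rightarrow> real" and w :: "real ^ 'n \<Rightarrow> real"
  defines "G \<equiv> {x. meval g x < 1}" and "G' \<equiv> {x. meval g' x < 1}"
  assumes deg: "\<And>\<alpha>. g \<alpha> \<noteq> 0 \<Longrightarrow> mdeg \<alpha> \<le> d" "\<And>\<alpha>. g' \<alpha> \<noteq> 0 \<Longrightarrow> mdeg \<alpha> \<le> d"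
    and bounded: "bounded G" "bounded G'"
    and w: "continuous_on UNIV w" "\<And>x. w x > 0"
    and moments: "\<And>\<alpha>. mdeg \<alpha> \<le> d \<Longrightarrow>
      (LINT x:G|lborel. monom x \<alpha> * w x) = (LINT x:G'|lborel. monom x \<alpha> * w x)"
  shows "AE x in lborel. x \<in> G \<longleftrightarrow> x \<in> G'"
proof -
  have sets: "G \<in> sets borel" "G' \<in> sets borel"
    unfolding G_def G'_def by (simp_all add: open_meval_less)
  have int: "set_integrable lborel S (\<lambda>x. meval c x * w x)" if "S \<in> {G, G'}" for S c
    using that bounded sets w(1)
    by (intro set_integrable_bounded_continuous continuous_intros) auto
  note ints = int[unfolded set_integrable_def]
  \<comment> \<open>Expanding \<open>c\<close> into monomials leaves only moments of order at most
    \<open>d\<close>, on which \<open>G\<close> and \<open>G'\<close> agree.\<close>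
  have eq: "(LINT x:G|lborel. meval c x * w x) = (LINT x:G'|lborel. meval c x * w x)"
    if "c \<in> {g, g'}" for c
    unfolding set_integral_meval[OF bounded(1) sets(1) w(1)]
      set_integral_meval[OF bounded(2) sets(2) w(1)]
    using that deg by (intro sum.cong) (auto simp: moments)
  \<comment> \<open>Four separately integrable terms, grouped so that each bracket integrates to 0
    by \<open>eq\<close>; \<open>F_eq\<close> gives the product form that shows the sign.\<close>
  define F where "F = (\<lambda>x.
    (indicator G x *\<^sub>R (meval g' x * w x) - indicator G' x *\<^sub>R (meval g' x * w x))
    - (indicator G x *\<^sub>R (meval g x * w x) - indicator G' x *\<^sub>R (meval g x * w x)))"
  have F_eq: "F x = (indicator G x - indicator G' x) * (meval g' x - meval g x) * w x" for x
    by (simp add: F_def algebra_simps)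
  have F_int: "integrable lborel F"
    unfolding F_def by (intro Bochner_Integration.integrable_diff ints) auto
  have "integral\<^sup>L lborel F = 0"
    unfolding F_def using eq[of g] eq[of g']
    by (simp add: ints set_lebesgue_integral_def del: real_scaleR_def)
  \<comment> \<open>The first two factors in \<open>F_eq\<close> are both positive on
    \<open>G - G'\<close> and both negative on \<open>G' - G\<close>; elsewhere the first one
    vanishes.\<close>
  moreover have F_nonneg: "F x \<ge> 0" for x
    using w(2)[of x] by (auto simp: F_eq G_def G'_def indicator_def)
  ultimately have "AE x in lborel. F x = 0"
    using F_int integral_nonneg_eq_0_iff_AE by blast
  then show ?thesis
  proof (rule AE_mp, intro AE_I2 impI)
    \<comment> \<open>If \<open>x\<close> lay in exactly one of the sets, 1 would separate
      \<open>meval g x\<close> from \<open>meval g' x\<close>, so no factor in \<open>F_eq\<close>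
      would vanish.\<close>
    fix x assume "F x = 0"
    then show "x \<in> G \<longleftrightarrow> x \<in> G'"
      using w(2)[of x] by (auto simp: F_eq G_def G'_def indicator_def split: if_splits)
  qed
qed

lemma set_integral_eq_if_AE_eq_sets:
  fixes f :: "'a::euclidean_space \<Rightarrow> real"
  assumes "A \<in> sets borel" "B \<in> sets borel" "continuous_on UNIV f"
    and "AE x in lborel. x \<in> A \<longleftrightarrow> x \<in> B"
  shows "(LINT x:A|lborel. f x) = (LINT x:B|lborel. f x)"
proof -
  have [measurable]: "f \<in> borel_measurable borel" "A \<in> sets borel" "B \<in> sets borel"
    using assms by (auto intro: borel_measurable_continuous_onI)
  show ?thesis
    unfolding set_lebesgue_integral_def
    using assms(4) by (intro integral_cong_AE) (auto simp: indicator_def elim: AE_mp)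
qed

text \<open>The moments of order at most \<open>d\<close> fix the set up to a null set, which no
  integral detects; hence \<open>\<alpha>\<close> is arbitrary in the conclusion.\<close>

lemma weighted_moments_eq:
  fixes g g' :: "('n::finite \<Rightarrow> nat) \<Rightarrow> real" and w :: "real ^ 'n \<Rightarrow> real"
  defines "G \<equiv> {x. meval g x < 1}" and "G' \<equiv> {x. meval g' x < 1}"
  assumes "\<And>\<alpha>. g \<alpha> \<noteq> 0 \<Longrightarrow> mdeg \<alpha> \<le> d" "\<And>\<alpha>. g' \<alpha> \<noteq> 0 \<Longrightarrow> mdeg \<alpha> \<le> d"
    and "bounded G" "bounded G'"
    and w: "continuous_on UNIV w" "\<And>x. w x > 0"
    and "\<And>\<alpha>. mdeg \<alpha> \<le> d \<Longrightarrow>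
      (LINT x:G|lborel. monom x \<alpha> * w x) = (LINT x:G'|lborel. monom x \<alpha> * w x)"
  shows "(LINT x:G|lborel. monom x \<alpha> * w x) = (LINT x:G'|lborel. monom x \<alpha> * w x)"
proof (rule set_integral_eq_if_AE_eq_sets)
  show "AE x in lborel. x \<in> G \<longleftrightarrow> x \<in> G'"
    unfolding G_def G'_def
    using assms by (intro weighted_moments_determine_sublevel_set[where d = d and w = w]) auto
qed (auto simp: G_def G'_def open_meval_less intro!: continuous_intros w)

theorem theorem2:
  fixes g g' p :: "('n::finite \<Rightarrow> nat) \<Rightarrow> real" and d t :: nat
  assumes "mpoly_degree_eq g d" and "mpoly_degree_eq g' d"
    and "bounded {x. meval g x < 1}" and "bounded {x. meval g' x < 1}"
    and "meval g 0 \<noteq> 1" and "meval g' 0 \<noteq> 1"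
    and "mpoly_degree_le p t"
  shows "((\<forall>\<alpha>. mdeg \<alpha> \<le> 3 * d \<longrightarrow>
             (LINT x:{x. meval g x < 1}|lborel. monom x \<alpha>) =
             (LINT x:{x. meval g' x < 1}|lborel. monom x \<alpha>))
          \<longrightarrow> (\<forall>\<alpha>. (LINT x:{x. meval g x < 1}|lborel. monom x \<alpha>) =
                    (LINT x:{x. meval g' x < 1}|lborel. monom x \<alpha>)))
       \<and> ((\<forall>\<alpha>. mdeg \<alpha> \<le> 3 * d + t \<longrightarrow>
             (LINT x:{x. meval g x < 1}|lborel. monom x \<alpha> * exp (meval p x)) =
             (LINT x:{x. meval g' x < 1}|lborel. monom x \<alpha> * exp (meval p x)))
          \<longrightarrow> (\<forall>\<alpha>. (LINT x:{x. meval g x < 1}|lborel. monom x \<alpha> * exp (meval p x)) =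
                    (LINT x:{x. meval g' x < 1}|lborel. monom x \<alpha> * exp (meval p x))))"
proof (intro conjI impI allI, goal_cases)
  \<comment> \<open>Weight 1, with \<open>d \<le> 3 * d\<close>.\<close>
  case (1 \<alpha>)
  then show ?case
    using assms weighted_moments_eq[of g d g' "\<lambda>_. 1" \<alpha>]
    by (simp add: mpoly_degree_eq_def)
next
  case (2 \<alpha>)
  \<comment> \<open>The weight is now the exponential, continuous and positive, with
    \<open>d \<le> 3 * d + t\<close>.\<close>
  have "continuous_on UNIV (\<lambda>x. exp (meval p x))"
    by (intro continuous_intros)
  with 2 show ?case
    using assms weighted_moments_eq[of g d g' "\<lambda>x. exp (meval p x)" \<alpha>]
    by (simp add: mpoly_degree_eq_def)
qed

end
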